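(* Let $\mathcal{D}=(\Omega,\mathcal{B})$ be a supersimple $2$-$(n,4,\lambda)$ design with $n>2\lambda+2$, and let $\mathcal{C}$ denote the set of all collinear triples of elements of $\Omega$. Let $\infty\in\Omega$ and define $G:=\mathcal{L}_\infty(\mathcal{D})$. Then: (a) if $G$ is a group, then $G$ is primitive on $\Omega$; (b) if $(\Omega,\mathcal{C})$ is a regular two-graph, then $\pi_\infty(\mathcal{D})$ is transitive on $\Omega\setminus\{\infty\}$; (c) if $(\Omega,\mathcal{C})$ is a regular two-graph and $G$ is a group, then $\pi_\infty(\mathcal{D})$ is primitive on $\Omega\setminus\{\infty\}$.
   Context: A $2$-$(n,4,\lambda)$ design $(\Omega,\mathcal{B})$ consists of a set $\Omega$ of $n$ points and a multiset $\mathcal{B}$ of $4$-subsets of $\Omega$ (lines) such that every $2$-subset of $\Omega$ lies in exactly $\lambda$ lines; it is supersimple if any two distinct lines meet in at most two points. For distinct $a,b\in\Omega$ there are $\lambda$ lines $\{a,b,a_i,b_i\}$ ($1\le i\le\lambda$) through $a,b$, and the points $a_1,\dots,a_\lambda,b_1,\dots,b_\lambda$ are pairwise distinct; the elementary move is $[a,b]:=(a,b)\prod_{i=1}^{\lambda}(a_i,b_i)\in\operatorname{Sym}(\Omega)$, and $[a,a]:=1$. Permutations act on the right and products are composed left to right. For $a_0,\dots,a_k\in\Omega$ the move sequence is $[a_0,a_1,\dots,a_k]:=[a_0,a_1][a_1,a_2]\cdots[a_{k-1},a_k]$. For $\infty\in\Omega$, $\mathcal{L}_\infty(\mathcal{D})$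 is the set of all move sequences $[\infty,a_1,\dots,a_k]$ ($k\ge1$) starting at $\infty$ (the Conway groupoid), and $\pi_\infty(\mathcal{D})$ is the set of all move sequences $[\infty,a_1,\dots,a_{k-1},\infty]$ starting and ending at $\infty$ (a subgroup of $\operatorname{Sym}(\Omega\setminus\{\infty\})$). A collinear triple is a $3$-subset of $\Omega$ contained in some line. A $2$-$(n,3,\mu)$ design $(\Omega,\mathcal{C})$ is a regular two-graph if every $4$-subset of $\Omega$ contains exactly $0$, $2$ or $4$ of the members of $\mathcal{C}$. *)

theory Defs
  imports Main "HOL-Library.Multiset"
begin

definition design_2_4 :: "'a set \<Rightarrow> 'a set multiset \<Rightarrow> nat \<Rightarrow> nat \<Rightarrow> bool" where
  "design_2_4 \<Omega> B n lam \<longleftrightarrow>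
     finite \<Omega> \<and> card \<Omega> = n \<and>
     (\<forall>L. L \<in># B \<longrightarrow> L \<subseteq> \<Omega> \<and> card L = 4) \<and>
     (\<forall>x\<in>\<Omega>. \<forall>y\<in>\<Omega>. x \<noteq> y \<longrightarrow> size (filter_mset (\<lambda>L. {x, y} \<subseteq> L) B) = lam)"

text \<open>Supersimple: any two distinct lines (distinct members of the multiset, i.e. also two
  copies of the same 4-set count as distinct lines) meet in at most two points.\<close>
definition supersimple :: "'a set multiset \<Rightarrow> bool" where
  "supersimple B \<longleftrightarrow>
     (\<forall>L. count B L \<le> 1) \<and>
     (\<forall>L1 L2. L1 \<in># B \<longrightarrow> L2 \<in># B \<longrightarrow> L1 \<noteq> L2 \<longrightarrow> card (L1 \<inter> L2) \<le> 2)"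

text \<open>Elementary move [a,b] = (a,b) prod_i (a_i,b_i), written out as a function: the
  transpositions are pairwise disjoint, so the product swaps a with b and, for each line
  {a,b,a_i,b_i}, swaps a_i with b_i; all other points are fixed. [a,a] = 1.\<close>
definition move :: "'a set multiset \<Rightarrow> 'a \<Rightarrow> 'a \<Rightarrow> 'a \<Rightarrow> 'a" where
  "move B a b x =
     (if a = b then x
      else if x = a then b
      else if x = b then a
      else if (\<exists>L. L \<in># B \<and> {a, b, x} \<subseteq> L)
        then (THE y. \<exists>L. L \<in># B \<and> L = {a, b, x, y} \<and> y \<notin> {a, b, x})
      else x)"

text \<open>Move sequences [a0,...,ak] = [a0,a1][a1,a2]...; permutations act on the right and
  products are composed left to right, so the first move is applied first.\<close>
fun mseq :: "'a set multiset \<Rightarrow> 'a list \<Rightarrow> 'a \<Rightarrow> 'a" where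
  "mseq B [] = id"
| "mseq B [a] = id"
| "mseq B (a # b # rest) = mseq B (b # rest) \<circ> move B a b"

definition Linf :: "'a set \<Rightarrow> 'a set multiset \<Rightarrow> 'a \<Rightarrow> ('a \<Rightarrow> 'a) set" where
  "Linf \<Omega> B oo = {mseq B (oo # as) | as. as \<noteq> [] \<and> set as \<subseteq> \<Omega>}"

definition pi_inf :: "'a set \<Rightarrow> 'a set multiset \<Rightarrow> 'a \<Rightarrow> ('a \<Rightarrow> 'a) set" where
  "pi_inf \<Omega> B oo = {mseq B (oo # as @ [oo]) | as. set as \<subseteq> \<Omega>}"

text \<open>A set of permutations (of the whole type, fixing points outside Omega) is a group
  under composition.\<close>
definition is_group :: "('a \<Rightarrow> 'a) set \<Rightarrow> bool" where
  "is_group G \<longleftrightarrow> id \<in> G \<and> (\<forall>g\<in>G. \<forall>h\<in>G. g \<circ> h \<in> G) \<and> (\<forall>g\<in>G. bij g \<and> inv g \<in> G)"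

definition transitive_on :: "('a \<Rightarrow> 'a) set \<Rightarrow> 'a set \<Rightarrow> bool" where
  "transitive_on G X \<longleftrightarrow> (\<forall>g\<in>G. g ` X = X) \<and> (\<forall>x\<in>X. \<forall>y\<in>X. \<exists>g\<in>G. g x = y)"

definition primitive_on :: "('a \<Rightarrow> 'a) set \<Rightarrow> 'a set \<Rightarrow> bool" where
  "primitive_on G X \<longleftrightarrow> transitive_on G X \<and>
     (\<forall>D. D \<subseteq> X \<longrightarrow> (\<forall>g\<in>G. g ` D = D \<or> g ` D \<inter> D = {}) \<longrightarrow>
          D = {} \<or> card D = 1 \<or> D = X)"

definition collinear_triples :: "'a set multiset \<Rightarrow> 'a set set" where
  "collinear_triples B = {T. card T = 3 \<and> (\<exists>L. L \<in># B \<and> T \<subseteq> L)}"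

definition regular_two_graph :: "'a set \<Rightarrow> 'a set set \<Rightarrow> bool" where
  "regular_two_graph \<Omega> C \<longleftrightarrow>
     finite \<Omega> \<and> (\<forall>T\<in>C. T \<subseteq> \<Omega> \<and> card T = 3) \<and>
     (\<exists>mu. \<forall>x\<in>\<Omega>. \<forall>y\<in>\<Omega>. x \<noteq> y \<longrightarrow> card {T\<in>C. {x, y} \<subseteq> T} = mu) \<and>
     (\<forall>F. F \<subseteq> \<Omega> \<longrightarrow> card F = 4 \<longrightarrow> card {T\<in>C. T \<subseteq> F} \<in> {0, 2, 4})"

end

theory Submission
  imports Defs
begin

text \<open>
  Write \<open>k = n - 2\<lambda> - 2 > 0\<close> for the number of points fixed by a move \<open>[a,b]\<close>, that is, not
  collinear with \<open>a, b\<close>.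

  (a) If \<open>G\<close> is a group, it contains every move. Let \<open>D\<close> be a block of size \<open>d\<close>, and let \<open>a \<in> D\<close>,
  \<open>c \<notin> D\<close>. Since \<open>[a,c]\<close> moves \<open>D\<close> off itself, it fixes no point of \<open>D\<close>; hence for \<open>a, b \<in> D\<close> all
  points fixed by \<open>[a,b]\<close> lie in \<open>D\<close>, and \<open>k \<le> d - 2\<close>. On the other hand, the block of a point fixed
  by \<open>[a,c]\<close> is fixed pointwise: if \<open>[a,c]\<close> swapped \<open>y, y'\<close> in it, then \<open>[y,a]\<close> would take \<open>y, y'\<close> to
  \<open>a, c\<close>, which lie in different blocks. So \<open>d \<le> k\<close>.

  (b) If \<open>\<infinity>, a, b\<close> are not collinear, \<open>[\<infinity>,a,b,\<infinity>]\<close> takes \<open>a\<close> to \<open>b\<close>. If they are collinear, the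
  parity condition of the two-graph gives \<open>k/2\<close> points \<open>x\<close> with neither \<open>\<infinity>, a, x\<close> nor \<open>\<infinity>, b, x\<close>
  collinear.

  (c) A block system of \<open>\<pi>\<^sub>\<infinity>\<close> with blocks of size \<open>d\<close>, where \<open>1 < d < n - 1\<close>, is carried by \<open>G\<close> to an
  equivalence relation \<open>T q\<close> on \<open>\<Omega> - {q}\<close> for each point \<open>q\<close>. Choose a noncollinear triple
  \<open>p, a, c\<close> with \<open>a, c\<close> in different classes of \<open>T p\<close>, and let \<open>F\<close> be the set of \<open>k\<close> points fixed by
  \<open>[a,c]\<close>. As in (a), \<open>F - {p}\<close> is a union of classes of \<open>T p\<close>, so \<open>d\<close> divides \<open>k - 1\<close>. This forces
  every triple \<open>q, x, y\<close> with \<open>x, y\<close> in one class of \<open>T q\<close> to be noncollinear (otherwise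
  \<open>k \<le> d - 2\<close>), so the sets \<open>{q} \<union> class\<close> are the lines of a Steiner system in which \<open>F\<close> together with
  the line \<open>Q\<close> through \<open>a, c\<close> is closed. Counting \<open>F - Q\<close> by the lines through a third point of
  \<open>Q\<close> shows that \<open>d\<close> divides \<open>k - (d - 1)\<close>. Hence \<open>d = 2\<close> and \<open>k\<close> is odd, whereas \<open>k\<close> is even by (b).
\<close>

section \<open>Counting by classes, and move sequences\<close>

lemma dvd_card_saturated:
  assumes fin: "finite S"
    and refl: "\<And>x. x \<in> S \<Longrightarrow> R x x"
    and sym: "\<And>x y. R x y \<Longrightarrow> R y x"
    and trans: "\<And>x y z. R x y \<Longrightarrow> R y z \<Longrightarrow> R x z"
    and sat: "\<And>x y. x \<in> S \<Longrightarrow> R x y \<Longrightarrow> y \<in> S"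
    and card: "\<And>x. x \<in> S \<Longrightarrow> card {y. R x y} = d"
  shows "d dvd card S"
proof -
  let ?C = "(\<lambda>x. {y. R x y}) ` S"
  have U: "\<Union>?C = S"
    using refl sat by blast
  have "d dvd card (\<Union>?C)"
  proof (rule dvd_partition)
    show "finite (\<Union>?C)" using U fin by simp
    show "\<forall>c\<in>?C. d dvd card c" using card by auto
    show "\<forall>c1\<in>?C. \<forall>c2\<in>?C. c1 \<noteq> c2 \<longrightarrow> c1 \<inter> c2 = {}"
    proof (clarify, rule ccontr)
      fix x y assume "{z. R x z} \<noteq> {z. R y z}" "{z. R x z} \<inter> {z. R y z} \<noteq> {}"
      then obtain z where "R x z" "R y z" by blast
      then have "{z. R x z} = {z. R y z}" using sym trans by blast
      with \<open>{z. R x z} \<noteq> {z. R y z}\<close> show False by simp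
    qed
  qed
  then show ?thesis using U by simp
qed

lemma mseq_append: "mseq B (xs @ a # ys) = mseq B (a # ys) \<circ> mseq B (xs @ [a])"
proof (induction xs)
  case Nil
  then show ?case by simp
next
  case (Cons b xs)
  then show ?case by (cases xs) (auto simp: comp_assoc)
qed

lemma move_self [simp]: "move B a a = id"
  by (auto simp: move_def fun_eq_iff)

lemma move_left [simp]: "move B a b a = b"
  by (auto simp: move_def)

lemma move_right [simp]: "move B a b b = a"
  by (auto simp: move_def)

lemma mseq_first: "mseq B (a # as) a = last (a # as)"
  by (induction as arbitrary: a) auto

section \<open>Collinearity and moves in a supersimple design\<close>

locale supersimple_design =
  fixes \<Omega> :: "'a set" and B :: "'a set multiset" and n lam :: nat
  assumes design: "design_2_4 \<Omega> B n lam"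
    and supersimple: "supersimple B"
begin

definition collinear :: "'a \<Rightarrow> 'a \<Rightarrow> 'a \<Rightarrow> bool" where
  "collinear a b x \<longleftrightarrow> a \<noteq> b \<and> a \<noteq> x \<and> b \<noteq> x \<and> (\<exists>L. L \<in># B \<and> {a, b, x} \<subseteq> L)"

text \<open>Distinctness and membership in \<open>\<Omega>\<close> are built in, so that for
  distinct points \<open>a\<close>, \<open>b\<close> of \<open>\<Omega>\<close> the set
  \<open>{x. noncol a b x}\<close> consists of the points of \<open>\<Omega>\<close> fixed by
  \<open>[a,b]\<close>.\<close>

definition noncol :: "'a \<Rightarrow> 'a \<Rightarrow> 'a \<Rightarrow> bool" where
  "noncol a b x \<longleftrightarrow> {a, b, x} \<subseteq> \<Omega> \<and> a \<noteq> b \<and> a \<noteq> x \<and> b \<noteq> x \<and> \<not> collinear a b x"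

lemma finite_points: "finite \<Omega>" and card_points: "card \<Omega> = n"
  and line_subset: "L \<in># B \<Longrightarrow> L \<subseteq> \<Omega>" and card_line: "L \<in># B \<Longrightarrow> card L = 4"
  using design by (auto simp: design_2_4_def)

lemma line_unique:
  assumes "L1 \<in># B" "L2 \<in># B" "{a, b, x} \<subseteq> L1" "{a, b, x} \<subseteq> L2" "a \<noteq> b" "a \<noteq> x" "b \<noteq> x"
  shows "L1 = L2"
proof (rule ccontr)
  assume "L1 \<noteq> L2"
  then have "card (L1 \<inter> L2) \<le> 2"
    using supersimple assms(1,2) by (auto simp: supersimple_def)
  moreover have "finite (L1 \<inter> L2)"
    using assms(1) line_subset finite_points by (meson finite_Int finite_subset)
  then have "card {a, b, x} \<le> card (L1 \<inter> L2)"
    using assms(3,4) by (intro card_mono) auto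
  ultimately show False using assms(5-7) by simp
qed

lemma collinear_commute:
  "collinear a b x \<longleftrightarrow> collinear b a x" "collinear a b x \<longleftrightarrow> collinear a x b"
  by (auto simp: collinear_def)

lemma noncol_commute:
  "noncol a b x \<longleftrightarrow> noncol b a x" "noncol a b x \<longleftrightarrow> noncol a x b"
  by (auto simp: noncol_def collinear_def)

lemma collinear_or_noncol:
  "{a, b, x} \<subseteq> \<Omega> \<Longrightarrow> a \<noteq> b \<Longrightarrow> a \<noteq> x \<Longrightarrow> b \<noteq> x \<Longrightarrow> collinear a b x \<longleftrightarrow> \<not> noncol a b x"
  by (auto simp: noncol_def)

lemma noncolD:
  "noncol a b x \<Longrightarrow> a \<in> \<Omega> \<and> b \<in> \<Omega> \<and> x \<in> \<Omega> \<and> a \<noteq> b \<and> a \<noteq> x \<and> b \<noteq> x \<and> \<not> collinear a b x"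
  by (auto simp: noncol_def)

text \<open>By \<open>line_unique\<close> the fourth point of a line through three given points is
  unique, so the definite description in \<open>move\<close> picks it out.\<close>

lemma move_line:
  assumes "{a, b, x, y} \<in># B" "distinct [a, b, x, y]"
  shows "move B a b x = y"
proof -
  have "(THE y. \<exists>L. L \<in># B \<and> L = {a, b, x, y} \<and> y \<notin> {a, b, x}) = y"
  proof (rule the_equality)
    show "\<exists>L. L \<in># B \<and> L = {a, b, x, y} \<and> y \<notin> {a, b, x}" using assms by auto
    fix z assume "\<exists>L. L \<in># B \<and> L = {a, b, x, z} \<and> z \<notin> {a, b, x}"
    then have z: "{a, b, x, z} \<in># B" "z \<notin> {a, b, x}" by auto
    have "{a, b, x, z} = {a, b, x, y}"
      by (rule line_unique[where a = a and b = b and x = x]) (use z assms in auto)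
    then show "z = y" using z by blast
  qed
  moreover have "\<exists>L. L \<in># B \<and> {a, b, x} \<subseteq> L" using assms(1) by blast
  ultimately show ?thesis using assms(2) by (auto simp: move_def)
qed

lemma collinear_move:
  assumes "collinear a b x"
  shows "{a, b, x, move B a b x} \<in># B" "distinct [a, b, x, move B a b x]"
proof -
  obtain L where L: "L \<in># B" "{a, b, x} \<subseteq> L" and d: "a \<noteq> b" "a \<noteq> x" "b \<noteq> x"
    using assms by (auto simp: collinear_def)
  have "finite L" using finite_subset[OF line_subset[OF L(1)] finite_points] .
  then have "card (L - {a, b, x}) = 1"
    using card_line[OF L(1)] d L(2) by (simp add: card_Diff_subset)
  then obtain y where y: "L - {a, b, x} = {y}" by (auto simp: card_1_singleton_iff)
  then have "L = {a, b, x, y}" using L(2) by blast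
  moreover have "distinct [a, b, x, y]" using y d by auto
  moreover from calculation have "move B a b x = y" using move_line L(1) by blast
  ultimately show "{a, b, x, move B a b x} \<in># B" "distinct [a, b, x, move B a b x]"
    using L(1) by simp_all
qed

lemma move_fixed: "\<not> collinear a b x \<Longrightarrow> x \<noteq> a \<Longrightarrow> x \<noteq> b \<Longrightarrow> move B a b x = x"
  by (auto simp: move_def collinear_def)

lemma move_noncol: "noncol a b x \<Longrightarrow> move B a b x = x"
  using noncolD[of a b x] move_fixed[of a b x] by metis

lemma noncol_if_fixed:
  assumes "move B a b x = x" "x \<noteq> a" "x \<noteq> b" "a \<noteq> b" "{a, b, x} \<subseteq> \<Omega>"
  shows "noncol a b x"
  using assms collinear_move(2)[of a b x] by (auto simp: noncol_def)

lemma move_move [simp]: "move B a b (move B a b x) = x"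
proof (cases "collinear a b x")
  case True
  then show ?thesis using collinear_move[OF True] move_line[of a b "move B a b x" x]
    by (auto simp: insert_commute)
next
  case False
  then show ?thesis using move_fixed by (metis move_left move_right)
qed

lemma bij_move: "bij (move B a b)"
  by (rule o_bij[of "move B a b"]) (auto simp: fun_eq_iff)

lemma collinear_in_points: "collinear a b x \<Longrightarrow> {a, b, x} \<subseteq> \<Omega>"
  using line_subset by (auto simp: collinear_def)

lemma move_in_points:
  assumes "a \<in> \<Omega>" "b \<in> \<Omega>" "x \<in> \<Omega>"
  shows "move B a b x \<in> \<Omega>"
proof (cases "collinear a b x")
  case True
  then show ?thesis using collinear_move(1) line_subset by blast
next
  case False
  then show ?thesis using move_fixed assms by (metis move_left move_right)
qed

lemma bij_mseq: "bij (mseq B as)"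
proof (induction as)
  case (Cons a as)
  then show ?case by (cases as) (simp_all add: bij_comp bij_move del: o_apply comp_apply flip: o_def)
qed (simp add: bij_id del: id_apply)

lemma mseq_in_points: "set as \<subseteq> \<Omega> \<Longrightarrow> x \<in> \<Omega> \<Longrightarrow> mseq B as x \<in> \<Omega>"
proof (induction as arbitrary: x)
  case (Cons a as)
  then show ?case by (cases as) (simp_all add: move_in_points)
qed simp

text \<open>The \<open>lam\<close> lines through \<open>a\<close> and \<open>b\<close> meet nowhere
  else by supersimplicity, and each adds two points.\<close>

lemma card_collinear:
  assumes "a \<in> \<Omega>" "b \<in> \<Omega>" "a \<noteq> b"
  shows "card {x. collinear a b x} = 2 * lam"
proof -
  let ?M = "filter_mset (\<lambda>L. {a, b} \<subseteq> L) B"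
  let ?S = "set_mset ?M"
  \<comment> \<open>No line is repeated, so the multiset size in \<open>design_2_4\<close> counts
    sets.\<close>
  have "?M = mset_set ?S"
  proof (rule multiset_eqI)
    fix L
    have "count ?M L \<le> 1" using supersimple by (auto simp: supersimple_def)
    then show "count ?M L = count (mset_set ?S) L"
      by (metis One_nat_def count_eq_zero_iff count_mset_set(1,3) finite_set_mset le_SucE le_zero_eq)
  qed
  then have cS: "card ?S = lam"
    using design assms by (metis design_2_4_def size_mset_set)
  have "{x. collinear a b x} = (\<Union>L\<in>?S. L - {a, b})"
    using assms(3) by (auto simp: collinear_def)
  also have "card \<dots> = (\<Sum>L\<in>?S. card (L - {a, b}))"
  proof (rule card_UN_disjoint)
    show "finite ?S" by simp
    show "\<forall>L\<in>?S. finite (L - {a, b})"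
      using line_subset finite_points by (auto intro: finite_subset)
    show "\<forall>L\<in>?S. \<forall>L'\<in>?S. L \<noteq> L' \<longrightarrow> (L - {a, b}) \<inter> (L' - {a, b}) = {}"
    proof (intro ballI impI, rule ccontr)
      fix L L' assume L: "L \<in> ?S" "L' \<in> ?S" "L \<noteq> L'" "(L - {a, b}) \<inter> (L' - {a, b}) \<noteq> {}"
      then obtain x where "x \<in> L" "x \<in> L'" "x \<noteq> a" "x \<noteq> b" by blast
      then have "L = L'"
        using L assms(3) by (intro line_unique[where a = a and b = b and x = x]) auto
      then show False using L by simp
    qed
  qed
  also have "\<dots> = (\<Sum>L\<in>?S. 2)"
  proof (rule sum.cong)
    fix L assume "L \<in> ?S"
    then have "card L = 4" "{a, b} \<subseteq> L" using card_line by auto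
    then show "card (L - {a, b}) = 2"
      using assms(3) by (subst card_Diff_subset) auto
  qed simp
  finally show ?thesis using cS by simp
qed

lemma finite_noncol [simp]: "finite {x. noncol a b x}"
  by (rule finite_subset[OF _ finite_points]) (auto simp: noncol_def)

lemma card_noncol:
  assumes "a \<in> \<Omega>" "b \<in> \<Omega>" "a \<noteq> b"
  shows "card {x. noncol a b x} = n - 2 * lam - 2"
proof -
  have "{x. noncol a b x} = \<Omega> - {a, b} - {x. collinear a b x}"
    using assms by (auto simp: noncol_def)
  moreover have "{x. collinear a b x} \<subseteq> \<Omega> - {a, b}"
    using collinear_in_points by (auto simp: collinear_def)
  ultimately have "card {x. noncol a b x} = card (\<Omega> - {a, b}) - 2 * lam"
    using card_collinear[OF assms] finite_points
    by (metis card_Diff_subset finite_Diff finite_subset)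
  also have "card (\<Omega> - {a, b}) = n - 2"
    using assms card_points finite_points by (subst card_Diff_subset) auto
  finally show ?thesis by simp
qed


section \<open>The block argument for (a)\<close>

text \<open>Free of groups: \<open>S\<close> stands for lying in a common block. Classes of size d
  with \<open>a\<close>, \<open>b\<close> together and \<open>c\<close> apart would force both k
  \<le> d - 2 and d \<le> k.\<close>

lemma invariant_equivalence_trivial:
  assumes large: "n > 2 * lam + 2"
    and refl: "\<And>x. x \<in> \<Omega> \<Longrightarrow> S x x"
    and sym: "\<And>x y. S x y \<Longrightarrow> S y x"
    and trans: "\<And>x y z. S x y \<Longrightarrow> S y z \<Longrightarrow> S x z"
    and dom: "\<And>x y. S x y \<Longrightarrow> x \<in> \<Omega>"
    and card: "\<And>x. x \<in> \<Omega> \<Longrightarrow> card {y. S x y} = d"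
    and inv: "\<And>a b x y. a \<in> \<Omega> \<Longrightarrow> b \<in> \<Omega> \<Longrightarrow> S x y \<Longrightarrow> S (move B a b x) (move B a b y)"
    and ab: "S a b" "a \<noteq> b" and c: "c \<in> \<Omega>"
  shows "S a c"
proof (rule ccontr)
  assume nS: "\<not> S a c"
  have fin: "finite {y. S x y}" for x
    by (rule finite_subset[OF _ finite_points]) (use sym dom in blast)
  have aO: "a \<in> \<Omega>" and bO: "b \<in> \<Omega>" using ab dom sym by blast+
  have ac: "a \<noteq> c" using nS refl aO by blast
  \<comment> \<open>Otherwise \<open>[x,z]\<close> fixes \<open>y\<close> and takes \<open>x\<close>
    to \<open>z\<close>, which relates \<open>z\<close> to \<open>y\<close>.\<close>
  have across: "collinear x z y" if "S x y" "x \<noteq> y" "\<not> S x z" "z \<in> \<Omega>" for x y z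
  proof (rule ccontr)
    assume n: "\<not> collinear x z y"
    have "x \<in> \<Omega>" using that dom by blast
    have "S z (move B x z y)" using inv[OF \<open>x \<in> \<Omega>\<close> that(4,1)] by simp
    moreover have "move B x z y = y" using move_fixed n that by metis
    ultimately show False using that sym trans by metis
  qed
  have "{x. noncol a b x} \<subseteq> {y. S a y} - {a, b}"
  proof
    fix x assume "x \<in> {x. noncol a b x}"
    then have x: "noncol a b x" by simp
    then have "S a x"
      using across[OF ab, of x] collinear_commute noncolD[OF x] by blast
    then show "x \<in> {y. S a y} - {a, b}" using noncolD[OF x] by blast
  qed
  then have "card {x. noncol a b x} \<le> card ({y. S a y} - {a, b})"
    using fin by (intro card_mono) auto
  also have "\<dots> = d - 2"
    using ab aO card[OF aO] refl by (subst card_Diff_subset) auto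
  finally have k: "n - 2 * lam - 2 \<le> d - 2" using card_noncol[OF aO bO ab(2)] by simp
  have "card {x. noncol a c x} \<noteq> 0" using card_noncol[OF aO c ac] large by simp
  then obtain x where x: "noncol a c x" by (metis (mono_tags) card.empty empty_Collect_eq)
  note xD = noncolD[OF x]
  have nSx: "\<not> S x a" "\<not> S x c"
    using across[of a x c] across[of c x a] sym xD nS collinear_commute c aO by blast+
  have "{y. S x y} \<subseteq> {y. noncol a c y}"
  proof
    fix y assume "y \<in> {y. S x y}"
    then have y: "S x y" by simp
    let ?y = "move B a c y"
    have yO: "y \<in> \<Omega>" using y sym dom by blast
    have ne: "y \<noteq> a" "y \<noteq> c" using y nSx by auto
    have "S x ?y" using inv[OF aO c y] move_noncol[OF x] by simp
    then have yy: "S y ?y" using y sym trans by blast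
    have "?y = y"
    proof (rule ccontr)
      assume "?y \<noteq> y"
      then have "collinear a c y" using move_fixed ne by blast
      note line = collinear_move[OF this]
      \<comment> \<open>\<open>[y,a]\<close> swaps \<open>y\<close> with \<open>a\<close> and, along
        this line, \<open>?y\<close> with \<open>c\<close>; so it takes the related pair
        \<open>y\<close>, \<open>?y\<close> to \<open>a\<close>, \<open>c\<close>.\<close>
      have "move B y a ?y = c"
        by (rule move_line) (use line in \<open>auto simp: insert_commute\<close>)
      then have "S a c" using inv[OF yO aO yy] by simp
      then show False using nS by simp
    qed
    then show "y \<in> {y. noncol a c y}" using noncol_if_fixed ne ac aO c yO by simp
  qed
  from card_mono[OF finite_noncol this] have "d \<le> n - 2 * lam - 2"
    using card[of x] xD card_noncol[OF aO c ac] by simp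
  \<comment> \<open>Truncated subtraction is harmless: for d < 2 the first bound reads k \<le> 0,
    against \<open>large\<close>.\<close>
  with k large show False by simp
qed

section \<open>Parity in the two-graph\<close>

text \<open>The nested equivalence says that an even number of the four triples is noncollinear,
  because 0, 2 or 4 of them are collinear.\<close>

lemma two_graph_parity:
  assumes tg: "regular_two_graph \<Omega> (collinear_triples B)"
    and pts: "{w, x, y, z} \<subseteq> \<Omega>" and d: "distinct [w, x, y, z]"
  shows "(noncol w x y \<longleftrightarrow> noncol w x z) \<longleftrightarrow> (noncol w y z \<longleftrightarrow> noncol x y z)"
proof -
  let ?C = "collinear_triples B"
  let ?F = "{w, x, y, z}"
  have "card ?F = 4" using d by simp
  then have c: "card {T \<in> ?C. T \<subseteq> ?F} \<in> {0, 2, 4}"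
    using tg pts unfolding regular_two_graph_def by blast
  have t: "{p, q, r} \<in> ?C \<longleftrightarrow> \<not> noncol p q r"
    if "p \<in> \<Omega>" "q \<in> \<Omega>" "r \<in> \<Omega>" "p \<noteq> q" "p \<noteq> r" "q \<noteq> r" for p q r
    using that by (auto simp: collinear_triples_def noncol_def collinear_def)
  have sub: "T \<in> {{w, x, y}, {w, x, z}, {w, y, z}, {x, y, z}}" if "T \<subseteq> ?F" "card T = 3" for T
  proof -
    have "finite T" using that(1) finite_subset by blast
    then have "card (?F - T) = 1" using that \<open>card ?F = 4\<close> by (simp add: card_Diff_subset)
    then obtain v where v: "?F - T = {v}" by (auto simp: card_1_singleton_iff)
    then have "T = ?F - {v}" "v \<in> ?F" using that by blast+
    then show ?thesis using d by auto
  qed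
  have "{T \<in> ?C. T \<subseteq> ?F} = {T \<in> {{w, x, y}, {w, x, z}, {w, y, z}, {x, y, z}}. T \<in> ?C}"
    using sub by (auto simp: collinear_triples_def)
  \<comment> \<open>With four optional singletons, splitting the conditionals evaluates the
    cardinality.\<close>
  also have "\<dots> = (if noncol w x y then {} else {{w, x, y}}) \<union> (if noncol w x z then {} else {{w, x, z}})
     \<union> (if noncol w y z then {} else {{w, y, z}}) \<union> (if noncol x y z then {} else {{x, y, z}})"
    using t[of w x y] t[of w x z] t[of w y z] t[of x y z] pts d by auto
  finally have e: "{T \<in> ?C. T \<subseteq> ?F} = \<dots>" .
  have ne: "{w, x, y} \<noteq> {w, x, z}" "{w, x, y} \<noteq> {w, y, z}" "{w, x, y} \<noteq> {x, y, z}"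
    "{w, x, z} \<noteq> {w, y, z}" "{w, x, z} \<noteq> {x, y, z}" "{w, y, z} \<noteq> {x, y, z}"
    using d by auto
  show ?thesis using c unfolding e using ne by (auto split: if_splits)
qed

text \<open>By parity the points fixed by \<open>[a,b]\<close> form the symmetric difference of
  those fixed by \<open>[p,a]\<close> and by \<open>[p,b]\<close>. All three sets have size k, so
  the intersection has k/2 points. In particular one collinear triple makes k even.\<close>

lemma card_common_noncol:
  assumes tg: "regular_two_graph \<Omega> (collinear_triples B)" and pab: "collinear p a b"
  shows "2 * card {x. noncol p a x \<and> noncol p b x} = n - 2 * lam - 2"
proof -
  let ?A = "{x. noncol p a x}" and ?B = "{x. noncol p b x}"
  have pts: "p \<in> \<Omega>" "a \<in> \<Omega>" "b \<in> \<Omega>" and d: "p \<noteq> a" "p \<noteq> b" "a \<noteq> b"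
    using pab collinear_in_points[OF pab] by (auto simp: collinear_def)
  have npab: "\<not> noncol p a b" "\<not> noncol p b a" "\<not> noncol a b p"
    using pab noncolD collinear_commute by blast+
  have "noncol a b x \<longleftrightarrow> (noncol p a x \<noteq> noncol p b x)" for x
  proof (cases "x \<in> \<Omega> \<and> x \<noteq> p \<and> x \<noteq> a \<and> x \<noteq> b")
    case True
    then show ?thesis using two_graph_parity[OF tg, of p a b x] pts d npab by auto
  next
    case False
    then show ?thesis using npab noncolD by blast
  qed
  then have "{x. noncol a b x} = (?A - ?B) \<union> (?B - ?A)" by blast
  moreover have "card \<dots> = card (?A - ?B) + card (?B - ?A)"
    by (rule card_Un_disjoint) auto
  ultimately have "card (?A - ?B) + card (?B - ?A) = n - 2 * lam - 2"
    using card_noncol pts d by metis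
  moreover have "card (?A - ?B) + card (?A \<inter> ?B) = card ?A"
    using card_Diff_subset_Int[of ?A ?B] card_mono[of ?A "?A \<inter> ?B"] by auto
  moreover have "card (?B - ?A) + card (?A \<inter> ?B) = card ?B"
    using card_Diff_subset_Int[of ?B ?A] card_mono[of ?B "?B \<inter> ?A"] by (auto simp: Int_commute)
  moreover have "?A \<inter> ?B = {x. noncol p a x \<and> noncol p b x}" by blast
  ultimately show ?thesis using card_noncol[of p a] card_noncol[of p b] pts d by simp
qed

lemma common_noncol:
  assumes tg: "regular_two_graph \<Omega> (collinear_triples B)" and large: "n > 2 * lam + 2"
    and "collinear p a b"
  obtains x where "noncol p a x" "noncol p b x"
proof -
  have "card {x. noncol p a x \<and> noncol p b x} \<noteq> 0"
    using card_common_noncol[OF tg assms(3)] large by linarith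
  then show ?thesis using that by (metis (mono_tags, lifting) card.empty empty_Collect_eq)
qed

end

section \<open>Invariant equivalence relations at each point\<close>

text \<open>For each point \<open>q\<close>, \<open>T q\<close> is an equivalence relation on the remaining points; it encodes the
  translates of a block system of the stabiliser of one point under a group containing all moves.\<close>

locale invariant_point_equivalences = supersimple_design \<Omega> B n lam
  for \<Omega> :: "'a set" and B n lam +
  fixes T :: "'a \<Rightarrow> 'a \<Rightarrow> 'a \<Rightarrow> bool" and d :: nat
  assumes tg: "regular_two_graph \<Omega> (collinear_triples B)"
    and large: "n > 2 * lam + 2"
    and T_refl: "q \<in> \<Omega> \<Longrightarrow> y \<in> \<Omega> \<Longrightarrow> q \<noteq> y \<Longrightarrow> T q y y"
    and T_sym: "T q y z \<Longrightarrow> T q z y"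
    and T_trans: "T q x y \<Longrightarrow> T q y z \<Longrightarrow> T q x z"
    and T_dom: "T q y z \<Longrightarrow> q \<in> \<Omega> \<and> y \<in> \<Omega> \<and> q \<noteq> y"
    and card_T: "q \<in> \<Omega> \<Longrightarrow> y \<in> \<Omega> \<Longrightarrow> q \<noteq> y \<Longrightarrow> card {z. T q y z} = d"
    and d_ge_2: "2 \<le> d"
    and T_move: "a \<in> \<Omega> \<Longrightarrow> b \<in> \<Omega> \<Longrightarrow> T q y z \<Longrightarrow> T (move B a b q) (move B a b y) (move B a b z)"
begin

lemma finite_T: "finite {z. T q y z}"
  by (rule finite_subset[OF _ finite_points]) (use T_sym T_dom in blast)

text \<open>\<open>[p,a]\<close> swaps \<open>p\<close> and \<open>a\<close> and fixes
  \<open>b\<close>.\<close>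

lemma T_noncol_rotate:
  assumes "noncol p a b" "T p a b"
  shows "T a p b"
proof -
  note D = noncolD[OF assms(1)]
  have "T (move B p a p) (move B p a a) (move B p a b)" using T_move D assms(2) by blast
  then show ?thesis using move_noncol[OF assms(1)] by simp
qed

lemma T_noncol_swap:
  assumes "noncol p a c" "T p a b"
  shows "T p c (move B a c b)"
proof -
  note D = noncolD[OF assms(1)]
  have "move B a c p = p" using assms(1) noncol_commute move_noncol by blast
  then show ?thesis using T_move[of a c p a b] D assms(2) by simp
qed

text \<open>Otherwise \<open>[a,c]\<close> fixes \<open>p\<close> and \<open>b\<close> and takes
  \<open>a\<close> to \<open>c\<close>, so \<open>T p\<close> relates \<open>b\<close> to both
  \<open>a\<close> and \<open>c\<close>.\<close>

lemma collinear_across: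
  assumes "noncol p a c" "\<not> T p a c" "T p a b" "b \<noteq> a"
  shows "collinear a c b"
proof (rule ccontr)
  assume n: "\<not> collinear a c b"
  have "b \<noteq> c" using assms by blast
  then have "move B a c b = b" using move_fixed n assms(4) by blast
  then have "T p c b" using T_noncol_swap[OF assms(1,3)] by simp
  then show False using assms(2,3) T_sym T_trans by blast
qed

text \<open>The move taking \<open>y\<close> and its image to \<open>a\<close> and \<open>c\<close>
  must now also fix \<open>p\<close>. Parity on \<open>p\<close>, \<open>a\<close>,
  \<open>c\<close>, \<open>y\<close> shows that exactly one of \<open>[y,a]\<close> and
  \<open>[y,c]\<close> does.\<close>

lemma fixed_if_class_fixed:
  assumes "noncol p a c" "\<not> T p a c" "T p y (move B a c y)"
  shows "move B a c y = y"
proof (rule ccontr)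
  let ?y = "move B a c y"
  assume ne: "?y \<noteq> y"
  note D = noncolD[OF assms(1)]
  have y: "y \<in> \<Omega>" "y \<noteq> p" using T_dom assms(3) by blast+
  have "y \<noteq> a" "y \<noteq> c" using assms(2,3) T_sym by auto
  then have col: "collinear a c y" using ne move_fixed by blast
  note line = collinear_move[OF col]
  have "noncol p a y \<longleftrightarrow> \<not> noncol p c y"
    using two_graph_parity[OF tg, of p a c y] D y \<open>y \<noteq> a\<close> \<open>y \<noteq> c\<close> col assms(1)
      noncolD[of a c y] by auto
  then consider "noncol p a y" | "noncol p c y" by blast
  then show False
  proof cases
    case 1
    have "move B y a ?y = c"
      by (rule move_line) (use line in \<open>auto simp: insert_commute\<close>)
    moreover have "move B y a p = p" using 1 noncol_commute move_noncol by blast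
    ultimately have "T p a c" using T_move[of y a p y ?y] y D assms(3) by simp
    then show False using assms(2) by simp
  next
    case 2
    have "move B y c ?y = a"
      by (rule move_line) (use line in \<open>auto simp: insert_commute\<close>)
    moreover have "move B y c p = p" using 2 noncol_commute move_noncol by blast
    ultimately have "T p c a" using T_move[of y c p y ?y] y D assms(3) by simp
    then show False using assms(2) T_sym by blast
  qed
qed

text \<open>\<open>[a,c]\<close> fixes \<open>p\<close> and \<open>x\<close>, so it preserves the
  class of \<open>x\<close> under \<open>T p\<close>, and fixes it pointwise by
  \<open>fixed_if_class_fixed\<close>.\<close>

lemma noncol_saturated:
  assumes "noncol p a c" "\<not> T p a c" "noncol a c x" "T p x y"
  shows "noncol a c y"
proof -
  note D = noncolD[OF assms(1)]
  have "move B a c p = p" using assms(1) noncol_commute move_noncol by blast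
  then have x: "T p x (move B a c y)"
    using T_move[of a c p x y] D assms(4) move_noncol[OF assms(3)] by simp
  then have "T p y (move B a c y)" using assms(4) T_sym T_trans by blast
  then have "move B a c y = y" using fixed_if_class_fixed assms by blast
  moreover have "y \<noteq> a" "y \<noteq> c"
    using x assms(2,4) T_sym T_trans move_left move_right by metis+
  moreover have "y \<in> \<Omega>" using assms(4) T_sym T_dom by blast
  ultimately show ?thesis using noncol_if_fixed D by simp
qed

text \<open>The points fixed by \<open>[a,c]\<close> split into classes of \<open>T p\<close>,
  except \<open>p\<close> itself, which lies in no class; hence the final 1.\<close>

lemma d_dvd_pred:
  assumes "noncol p a c" "\<not> T p a c"
  shows "d dvd n - 2 * lam - 2 - 1"
proof -
  note D = noncolD[OF assms(1)]
  let ?F = "{x. noncol a c x} - {p}"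
  have "d dvd card ?F"
  proof (rule dvd_card_saturated[where R = "T p"])
    show "T p x x" if "x \<in> ?F" for x using that T_refl D noncolD by blast
    show "y \<in> ?F" if "x \<in> ?F" "T p x y" for x y
      using noncol_saturated[OF assms, of x y] that T_sym T_dom by blast
    show "card {y. T p x y} = d" if "x \<in> ?F" for x using that card_T D noncolD by blast
    show "finite ?F" by simp
  qed (fact T_sym T_trans)+
  moreover have "p \<in> {x. noncol a c x}" using assms(1) noncol_commute by blast
  then have "card ?F = n - 2 * lam - 2 - 1"
    using card_noncol D by (simp add: card_Diff_singleton)
  ultimately show ?thesis by simp
qed

lemma T_all:
  assumes p: "p \<in> \<Omega>" "u \<in> \<Omega>" "v \<in> \<Omega>" "p \<noteq> u" "p \<noteq> v"
  shows "T p u v"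
proof (rule ccontr)
  assume "\<not> T p u v"
  \<comment> \<open>In the collinear case \<open>w\<close> cannot be related to both
    \<open>u\<close> and \<open>v\<close>, so one of the pairs \<open>u\<close>, \<open>w\<close>
    and \<open>v\<close>, \<open>w\<close> serves.\<close>
  obtain a c where ac: "noncol p a c" "\<not> T p a c"
  proof (cases "noncol p u v")
    case True
    then show ?thesis using that \<open>\<not> T p u v\<close> by blast
  next
    case False
    have "u \<noteq> v" using T_refl p \<open>\<not> T p u v\<close> by blast
    then have "collinear p u v" using False p collinear_or_noncol by simp
    then obtain w where "noncol p u w" "noncol p v w" by (rule common_noncol[OF tg large])
    then show ?thesis using that \<open>\<not> T p u v\<close> T_sym T_trans by blast
  qed
  note D = noncolD[OF ac(1)]
  define k where "k = n - 2 * lam - 2"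
  have "k > 0" using large by (simp add: k_def)
  have other: "\<exists>z. T q y z \<and> z \<noteq> y" if "q \<in> \<Omega>" "y \<in> \<Omega>" "q \<noteq> y" for q y
  proof (rule ccontr)
    assume "\<nexists>z. T q y z \<and> z \<noteq> y"
    then have "{z. T q y z} \<subseteq> {y}" by blast
    from card_mono[OF _ this] show False using card_T[OF that] d_ge_2 by simp
  qed
  obtain b where b: "T p a b" "b \<noteq> a" using other D by blast
  \<comment> \<open>\<open>collinear_across\<close> supplies the collinear triple \<open>a\<close>,
    \<open>c\<close>, \<open>b\<close> on which to count.\<close>
  have "even k"
    using card_common_noncol[OF tg collinear_across[OF ac b]] unfolding k_def by (metis dvd_triv_left)
  have dvd1: "d dvd k - 1" using d_dvd_pred[OF ac] by (simp add: k_def)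
  \<comment> \<open>Otherwise the points fixed by \<open>[x,y]\<close> all lie in the class of
    \<open>x\<close>, so k \<le> d - 2; as d divides k - 1, this leaves only the odd value k =
    1.\<close>
  have clique: "noncol q x y" if T: "T q x y" "x \<noteq> y" for q x y
  proof (rule ccontr)
    assume nc: "\<not> noncol q x y"
    have pts: "q \<in> \<Omega>" "x \<in> \<Omega>" "y \<in> \<Omega>" "q \<noteq> x" "q \<noteq> y" using T T_dom T_sym by blast+
    have "{z. noncol x y z} \<subseteq> {z. T q x z} - {x, y}"
    proof
      fix z assume "z \<in> {z. noncol x y z}"
      then have z: "noncol x y z" by simp
      note zD = noncolD[OF z]
      have "z \<noteq> q" using z nc noncol_commute by blast
      have "T q x z"
      proof (rule ccontr)
        assume nT: "\<not> T q x z"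
        then have nT': "\<not> T q y z" using T T_trans by blast
        \<comment> \<open>With \<open>z\<close> outside the class, \<open>x\<close>,
          \<open>y\<close>, \<open>z\<close> turns out to be the only noncollinear triple among the
          four points, against parity.\<close>
        have "\<not> noncol q x z"
          using collinear_across[of q x z y] nT T zD collinear_commute by blast
        moreover have "\<not> noncol q y z"
          using collinear_across[of q y z x] nT' T T_sym zD collinear_commute by blast
        ultimately show False
          using two_graph_parity[OF tg, of q x y z] nc z zD pts \<open>z \<noteq> q\<close> by simp
      qed
      then show "z \<in> {z. T q x z} - {x, y}" using zD by blast
    qed
    then have "card {z. noncol x y z} \<le> card ({z. T q x z} - {x, y})"
      using finite_T by (intro card_mono) auto
    also have "\<dots> = d - 2"
      using T pts T_refl card_T by (subst card_Diff_subset) auto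
    finally have "k \<le> d - 2" using card_noncol pts T by (simp add: k_def)
    then have "k - 1 < d" using d_ge_2 by simp
    then have "k - 1 = 0" using dvd1 nat_dvd_not_less by blast
    then show False using \<open>even k\<close> \<open>k > 0\<close> by auto
  qed
  \<comment> \<open>On distinct points \<open>T\<close> is now symmetric in all three arguments: the
    Steiner lines are a point \<open>q\<close> with a class of \<open>T q\<close>.\<close>
  have rotate: "T x q y" if "T q x y" "x \<noteq> y" for q x y
    using T_noncol_rotate clique that by blast
  obtain x where x: "T a c x" "x \<noteq> c" using other D by blast
  note xD = noncolD[OF clique[OF x(1) x(2)[symmetric]]]
  \<comment> \<open>\<open>?Q\<close> is the Steiner line through \<open>a\<close> and
    \<open>c\<close> without these two points; it contains \<open>x\<close>.\<close>
  let ?F = "{y. noncol a c y}" and ?Q = "{y. T a c y} - {c}"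
  have QF: "?Q \<subseteq> ?F" using clique by blast
  have "d dvd card (?F - ?Q)"
  proof (rule dvd_card_saturated[where R = "T x"])
    show "T x y y" if "y \<in> ?F - ?Q" for y
      using that x xD noncolD[of a c y] T_refl by blast
    show "card {z. T x y z} = d" if "y \<in> ?F - ?Q" for y
      using that x xD noncolD[of a c y] card_T by blast
    \<comment> \<open>\<open>z\<close> is on the Steiner line through \<open>x\<close> and
      \<open>y\<close>. It lies in \<open>?F\<close> by \<open>noncol_saturated\<close> based at
      \<open>y\<close>; if it lay in \<open>?Q\<close>, that line would be the one through
      \<open>a\<close> and \<open>c\<close>, putting \<open>y\<close> in \<open>?Q\<close>.\<close>
    show "z \<in> ?F - ?Q" if y: "y \<in> ?F - ?Q" and z: "T x y z" for y z
    proof (cases "z = y")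
      case True
      then show ?thesis using y by simp
    next
      case False
      have yac: "noncol a c y" "noncol y a c" "\<not> T a c y" "y \<noteq> a"
        using y noncol_commute noncolD[of a c y] by blast+
      have "\<not> T y a c"
        using rotate[of y a c] D yac(3) T_sym noncol_commute by (metis T_noncol_rotate)
      then have "noncol a c z"
        using noncol_saturated[OF yac(2)] clique[OF x(1) x(2)[symmetric]] rotate[OF z] False
        by blast
      moreover have "\<not> T a c z"
      proof
        assume "T a c z"
        then have "T a x z" using x T_sym T_trans by blast
        moreover have "x \<noteq> z" using z T_sym T_dom by blast
        ultimately have "T x a z" using rotate by blast
        then have "T x a y" using z T_sym T_trans by blast
        then have "T a x y" using rotate yac(4) by blast
        then show False using yac(3) x T_trans by blast
      qed
      ultimately show ?thesis by blast
    qed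
    show "finite (?F - ?Q)" by simp
  qed (fact T_sym T_trans)+
  moreover have cQ: "card ?Q = d - 1"
    using card_T[of a c] T_refl[of a c] D by (simp add: card_Diff_singleton)
  moreover have "card (?F - ?Q) = card ?F - card ?Q"
    using QF finite_T by (intro card_Diff_subset) auto
  moreover have cF: "card ?F = k" using card_noncol D by (simp add: k_def)
  ultimately have "d dvd k - (d - 1)" by simp
  moreover have "d - 1 \<le> k" using card_mono[OF _ QF] cQ cF by simp
  \<comment> \<open>The difference of the two multiples of d is d - 2, with no truncation since d -
    1 \<le> k.\<close>
  ultimately have "d dvd (k - 1) - (k - (d - 1))" using dvd1 by (metis dvd_diff_nat)
  moreover have "(k - 1) - (k - (d - 1)) = d - 2" using \<open>d - 1 \<le> k\<close> d_ge_2 by simp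
  ultimately have "d dvd d - 2" by simp
  moreover have "d - 2 < d" using d_ge_2 by simp
  ultimately have "d - 2 = 0" using nat_dvd_not_less by blast
  then have "d = 2" using d_ge_2 by simp
  then have "even (k - 1)" using dvd1 by simp
  then show False using \<open>even k\<close> \<open>k > 0\<close> by auto
qed

end

section \<open>From blocks to invariant equivalence relations\<close>

text \<open>\<open>g1 \<circ> inv g2\<close> takes \<open>g2 z\<close> to \<open>g1 z\<close>, both
  in \<open>D\<close>, so it stabilises the block and keeps the image of \<open>g2 w\<close> in
  it.\<close>

lemma block_transfer:
  assumes "bij g2"
    and "(g1 \<circ> inv g2) ` D = D \<or> (g1 \<circ> inv g2) ` D \<inter> D = {}"
    and "g1 z \<in> D" "g2 z \<in> D" "g2 w \<in> D"
  shows "g1 w \<in> D"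
proof -
  have h: "(g1 \<circ> inv g2) (g2 x) = g1 x" for x
    using assms(1) by (simp add: bij_is_inj)
  then have "g1 z \<in> (g1 \<circ> inv g2) ` D" using assms(4) by (metis imageI)
  then have "(g1 \<circ> inv g2) ` D = D" using assms(2,3) by blast
  then show ?thesis using h assms(5) by (metis imageI)
qed

context supersimple_design
begin

lemma Linf_bij: "g \<in> Linf \<Omega> B oo \<Longrightarrow> bij g"
  using bij_mseq by (auto simp: Linf_def)

lemma Linf_image:
  assumes "oo \<in> \<Omega>" "g \<in> Linf \<Omega> B oo"
  shows "g ` \<Omega> = \<Omega>"
proof (rule endo_inj_surj[OF finite_points])
  show "g ` \<Omega> \<subseteq> \<Omega>" using assms mseq_in_points by (force simp: Linf_def)
  show "inj_on g \<Omega>" using Linf_bij[OF assms(2)] by (meson bij_is_inj inj_on_subset subset_UNIV)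
qed

lemma Linf_in_points_iff:
  assumes "oo \<in> \<Omega>" "g \<in> Linf \<Omega> B oo"
  shows "g x \<in> \<Omega> \<longleftrightarrow> x \<in> \<Omega>"
  using Linf_image[OF assms] Linf_bij[OF assms(2)] by (metis bij_is_inj inj_image_mem_iff)

text \<open>Precomposing \<open>[oo,a,b]\<close> with the involution \<open>[oo,a]\<close> cancels
  its first factor.\<close>

lemma move_in_Linf:
  assumes "is_group (Linf \<Omega> B oo)" "a \<in> \<Omega>" "b \<in> \<Omega>"
  shows "move B a b \<in> Linf \<Omega> B oo"
proof -
  have 1: "move B oo a \<in> Linf \<Omega> B oo"
    unfolding Linf_def using assms(2) by (intro CollectI exI[of _ "[a]"]) auto
  have "move B a b \<circ> move B oo a \<in> Linf \<Omega> B oo"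
    unfolding Linf_def using assms(2,3) by (intro CollectI exI[of _ "[a, b]"]) auto
  then have "(move B a b \<circ> move B oo a) \<circ> move B oo a \<in> Linf \<Omega> B oo"
    using assms(1) 1 by (simp add: is_group_def)
  moreover have "(move B a b \<circ> move B oo a) \<circ> move B oo a = move B a b"
    by (simp add: fun_eq_iff)
  ultimately show ?thesis by simp
qed

text \<open>A move sequence takes its first point to its last, by \<open>mseq_first\<close>.\<close>

lemma pi_inf_eq_stabilizer:
  assumes "oo \<in> \<Omega>"
  shows "pi_inf \<Omega> B oo = {g \<in> Linf \<Omega> B oo. g oo = oo}"
proof (intro equalityI subsetI)
  fix g assume "g \<in> pi_inf \<Omega> B oo"
  then obtain as where g: "g = mseq B (oo # as @ [oo])" "set as \<subseteq> \<Omega>"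
    by (auto simp: pi_inf_def)
  then have "g \<in> Linf \<Omega> B oo"
    unfolding Linf_def using assms by (intro CollectI exI[of _ "as @ [oo]"]) auto
  then show "g \<in> {g \<in> Linf \<Omega> B oo. g oo = oo}" using g by (simp add: mseq_first)
next
  fix g assume "g \<in> {g \<in> Linf \<Omega> B oo. g oo = oo}"
  then obtain as where g: "g = mseq B (oo # as)" "as \<noteq> []" "set as \<subseteq> \<Omega>" and "g oo = oo"
    by (auto simp: Linf_def)
  then have "last as = oo" by (simp add: mseq_first)
  then have "as = butlast as @ [oo]" using g(2) by (metis append_butlast_last_id)
  moreover have "set (butlast as) \<subseteq> \<Omega>" using g(3) by (meson in_set_butlastD subset_eq)
  ultimately show "g \<in> pi_inf \<Omega> B oo" 
    unfolding pi_inf_def g(1) by (intro CollectI exI[of _ "butlast as"]) simp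
qed

text \<open>Closed walks at \<open>oo\<close> concatenate, so (b) can compose elements without
  assuming a group.\<close>

lemma pi_inf_comp:
  assumes "g \<in> pi_inf \<Omega> B oo" "h \<in> pi_inf \<Omega> B oo" "oo \<in> \<Omega>"
  shows "g \<circ> h \<in> pi_inf \<Omega> B oo"
proof -
  obtain as bs where "g = mseq B (oo # as @ [oo])" "h = mseq B (oo # bs @ [oo])"
    and sub: "set as \<subseteq> \<Omega>" "set bs \<subseteq> \<Omega>"
    using assms by (auto simp: pi_inf_def)
  then have "g \<circ> h = mseq B (oo # (bs @ oo # as) @ [oo])"
    using mseq_append[of B "oo # bs" oo "as @ [oo]"] by simp
  then show ?thesis
    unfolding pi_inf_def using sub assms(3) by (intro CollectI exI[of _ "bs @ oo # as"]) auto
qed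

lemma primitive_Linf:
  assumes large: "n > 2 * lam + 2" and oo: "oo \<in> \<Omega>" and grp: "is_group (Linf \<Omega> B oo)"
  shows "primitive_on (Linf \<Omega> B oo) \<Omega>"
  unfolding primitive_on_def
proof (intro conjI allI impI)
  let ?G = "Linf \<Omega> B oo"
  show tr: "transitive_on ?G \<Omega>"
    unfolding transitive_on_def using Linf_image[OF oo] move_in_Linf[OF grp] move_left by metis
  fix D assume D: "D \<subseteq> \<Omega>" and block: "\<forall>g\<in>?G. g ` D = D \<or> g ` D \<inter> D = {}"
  show "D = {} \<or> card D = 1 \<or> D = \<Omega>"
  proof (rule ccontr)
    assume "\<not> (D = {} \<or> card D = 1 \<or> D = \<Omega>)"
    then have "D \<noteq> {}" "card D \<noteq> 1" "D \<noteq> \<Omega>" by auto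
    then obtain a where a: "a \<in> D" by blast
    have "D \<noteq> {a}" using \<open>card D \<noteq> 1\<close> by auto
    then obtain b where b: "b \<in> D" "a \<noteq> b" using a by blast
    obtain c where c: "c \<in> \<Omega>" "c \<notin> D" using D \<open>D \<noteq> \<Omega>\<close> by blast
    \<comment> \<open>Lying in a common translate of \<open>D\<close>; by \<open>transfer\<close>,
      any \<open>g\<close> with \<open>g y\<close> in \<open>D\<close> decides this.\<close>
    define S where "S y z \<longleftrightarrow> (\<exists>g\<in>?G. g y \<in> D \<and> g z \<in> D)" for y z
    have id: "id \<in> ?G" using grp by (simp add: is_group_def)
    have transfer: "g1 w \<in> D"
      if "g1 \<in> ?G" "g2 \<in> ?G" "g1 z \<in> D" "g2 z \<in> D" "g2 w \<in> D" for g1 g2 z w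
    proof (rule block_transfer[of g2 g1 D z w])
      have "g1 \<circ> inv g2 \<in> ?G" using grp that(1,2) by (simp add: is_group_def)
      then show "(g1 \<circ> inv g2) ` D = D \<or> (g1 \<circ> inv g2) ` D \<inter> D = {}" using block by blast
    qed (use that Linf_bij in auto)
    have "S a c"
    proof (rule invariant_equivalence_trivial[OF large, where S = S and d = "card D" and b = b])
      show refl: "S x x" if "x \<in> \<Omega>" for x
        using tr that a D unfolding S_def transitive_on_def by (metis subsetD)
      show "S y x" if "S x y" for x y using that by (auto simp: S_def)
      show "S x z" if "S x y" "S y z" for x y z
        using that transfer unfolding S_def by blast
      show "x \<in> \<Omega>" if "S x y" for x y
        using that D Linf_in_points_iff[OF oo] unfolding S_def by blast
      show "card {y. S x y} = card D" if x: "x \<in> \<Omega>" for x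
      proof -
        obtain g where g: "g \<in> ?G" "g x \<in> D" using refl[OF x] by (auto simp: S_def)
        have "{y. S x y} = g -` D"
          using g transfer unfolding S_def by blast
        then show ?thesis
          using Linf_bij[OF g(1)] by (simp add: card_vimage_inj bij_is_inj bij_is_surj)
      qed
      show "S (move B p q x) (move B p q y)" if pq: "p \<in> \<Omega>" "q \<in> \<Omega>" and S: "S x y" for p q x y
      proof -
        obtain g where g: "g \<in> ?G" "g x \<in> D" "g y \<in> D"
          using S unfolding S_def by blast
        have "g \<circ> move B p q \<in> ?G"
          using grp g(1) move_in_Linf[OF grp pq] by (simp add: is_group_def)
        then show ?thesis using g unfolding S_def by (intro bexI[of _ "g \<circ> move B p q"]) auto
      qed
      show "S a b" using id a b unfolding S_def by (intro bexI[of _ id]) auto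
    qed (use b c in auto)
    then obtain g where "g \<in> ?G" "g a \<in> D" "g c \<in> D" by (auto simp: S_def)
    then have "id c \<in> D" using transfer[OF id, of g a c] a by simp
    then show False using c by simp
  qed
qed

lemma transitive_pi_inf:
  assumes large: "n > 2 * lam + 2" and oo: "oo \<in> \<Omega>"
    and tg: "regular_two_graph \<Omega> (collinear_triples B)"
  shows "transitive_on (pi_inf \<Omega> B oo) (\<Omega> - {oo})"
  unfolding transitive_on_def
proof (intro conjI ballI)
  fix g assume "g \<in> pi_inf \<Omega> B oo"
  then have g: "g \<in> Linf \<Omega> B oo" "g oo = oo" using pi_inf_eq_stabilizer[OF oo] by auto
  then have "g ` (\<Omega> - {oo}) = g ` \<Omega> - g ` {oo}"
    using Linf_bij by (metis bij_is_inj image_set_diff)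
  then show "g ` (\<Omega> - {oo}) = \<Omega> - {oo}" using Linf_image[OF oo] g by simp
next
  have step: "\<exists>g\<in>pi_inf \<Omega> B oo. g a = b" if "noncol oo a b" for a b
  proof
    note D = noncolD[OF that]
    show "mseq B (oo # [a, b] @ [oo]) \<in> pi_inf \<Omega> B oo"
      unfolding pi_inf_def using D by (intro CollectI exI[of _ "[a, b]"]) auto
    \<comment> \<open>\<open>a\<close> goes to \<open>oo\<close>, stays there under
      \<open>[a,b]\<close>, and is taken to \<open>b\<close> by \<open>[b,oo]\<close>.\<close>
    have "move B a b oo = oo" using that noncol_commute move_noncol by blast
    then show "mseq B (oo # [a, b] @ [oo]) a = b" by simp
  qed
  fix a b assume ab: "a \<in> \<Omega> - {oo}" "b \<in> \<Omega> - {oo}"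
  consider "a = b" | "noncol oo a b" | "collinear oo a b"
    using ab oo collinear_or_noncol by blast
  then show "\<exists>g\<in>pi_inf \<Omega> B oo. g a = b"
  proof cases
    case 1
    have "mseq B (oo # [] @ [oo]) \<in> pi_inf \<Omega> B oo"
      unfolding pi_inf_def by (intro CollectI exI[of _ "[]"]) auto
    then show ?thesis using 1 by (intro bexI[of _ "mseq B (oo # [] @ [oo])"]) auto
  next
    case 2
    then show ?thesis using step by blast
  next
    case 3
    then obtain c where "noncol oo a c" "noncol oo b c" by (rule common_noncol[OF tg large])
    then obtain g h where gh: "g \<in> pi_inf \<Omega> B oo" "g a = c" "h \<in> pi_inf \<Omega> B oo" "h c = b"
      using step noncol_commute by metis
    then show ?thesis using pi_inf_comp[OF gh(3,1) oo] by (intro bexI[of _ "h \<circ> g"]) auto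
  qed
qed

lemma primitive_pi_inf:
  assumes large: "n > 2 * lam + 2" and oo: "oo \<in> \<Omega>"
    and tg: "regular_two_graph \<Omega> (collinear_triples B)" and grp: "is_group (Linf \<Omega> B oo)"
  shows "primitive_on (pi_inf \<Omega> B oo) (\<Omega> - {oo})"
  unfolding primitive_on_def
proof (intro conjI allI impI)
  let ?G = "Linf \<Omega> B oo"
  show tr: "transitive_on (pi_inf \<Omega> B oo) (\<Omega> - {oo})" using transitive_pi_inf[OF large oo tg] .
  note stab = pi_inf_eq_stabilizer[OF oo]
  fix D assume D: "D \<subseteq> \<Omega> - {oo}"
    and block: "\<forall>g\<in>pi_inf \<Omega> B oo. g ` D = D \<or> g ` D \<inter> D = {}"
  show "D = {} \<or> card D = 1 \<or> D = \<Omega> - {oo}"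
  proof (rule ccontr)
    assume "\<not> (D = {} \<or> card D = 1 \<or> D = \<Omega> - {oo})"
    then have nt: "D \<noteq> {}" "card D \<noteq> 1" "D \<noteq> \<Omega> - {oo}" by auto
    then obtain a where a: "a \<in> D" by blast
    obtain c where c: "c \<in> \<Omega>" "c \<noteq> oo" "c \<notin> D" using D nt(3) by blast
    have finD: "finite D" using D finite_points finite_subset by (metis finite_Diff)
    then have "card D \<ge> 2" using nt by (metis One_nat_def Suc_leI card_gt_0_iff le_neq_implies_less
          numeral_2_eq_2)
    \<comment> \<open>The classes of \<open>T q\<close> are the translates of \<open>D\<close> by
      inverses of elements taking \<open>q\<close> to \<open>oo\<close>.\<close>
    define T where "T q y z \<longleftrightarrow> (\<exists>g\<in>?G. g q = oo \<and> g y \<in> D \<and> g z \<in> D)" for q y z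
    have id: "id \<in> ?G" using grp by (simp add: is_group_def)
    have comp: "g \<circ> h \<in> ?G" if "g \<in> ?G" "h \<in> ?G" for g h
      using grp that by (simp add: is_group_def)
    have transfer: "g1 w \<in> D"
      if g: "g1 \<in> ?G" "g2 \<in> ?G" "g1 q = oo" "g2 q = oo" and "g1 z \<in> D" "g2 z \<in> D" "g2 w \<in> D"
      for g1 g2 q z w
    proof (rule block_transfer[of g2 g1 D z w])
      have "inv g2 \<in> ?G" using grp g(2) by (simp add: is_group_def)
      moreover have "inv g2 oo = q" using g(4) Linf_bij[OF g(2)] by (metis bij_is_inj inv_f_f)
      ultimately have "g1 \<circ> inv g2 \<in> pi_inf \<Omega> B oo" using stab comp g by simp
      then show "(g1 \<circ> inv g2) ` D = D \<or> (g1 \<circ> inv g2) ` D \<inter> D = {}" using block by blast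
    qed (use that Linf_bij in auto)
    have refl: "T q y y" if q: "q \<in> \<Omega>" "y \<in> \<Omega>" "q \<noteq> y" for q y
    proof -
      \<comment> \<open>\<open>?m\<close> takes \<open>q\<close> to \<open>oo\<close>; transitivity
        of the stabiliser then brings the image of \<open>y\<close> into \<open>D\<close>.\<close>
      let ?m = "move B q oo"
      have "?m y \<in> \<Omega>" using move_in_points q oo by blast
      moreover have "?m y \<noteq> oo" using q(3) by (metis move_left move_move)
      ultimately obtain h where h: "h \<in> pi_inf \<Omega> B oo" "h (?m y) = a"
        using tr a D unfolding transitive_on_def by blast
      then have "h \<circ> ?m \<in> ?G" "h oo = oo" using stab comp move_in_Linf[OF grp q(1) oo] by auto
      then show ?thesis using h a unfolding T_def by (intro bexI[of _ "h \<circ> ?m"]) auto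
    qed
    interpret invariant_point_equivalences \<Omega> B n lam T "card D"
    proof
      show "T q y y" if "q \<in> \<Omega>" "y \<in> \<Omega>" "q \<noteq> y" for q y using refl that .
      show "T q z y" if "T q y z" for q y z using that by (auto simp: T_def)
      show "T q x z" if "T q x y" "T q y z" for q x y z
        using that transfer unfolding T_def by blast
      show "q \<in> \<Omega> \<and> y \<in> \<Omega> \<and> q \<noteq> y" if "T q y z" for q y z
        using that D Linf_in_points_iff[OF oo] oo unfolding T_def by blast
      show "card {z. T q y z} = card D" if q: "q \<in> \<Omega>" "y \<in> \<Omega>" "q \<noteq> y" for q y
      proof -
        obtain g where g: "g \<in> ?G" "g q = oo" "g y \<in> D" using refl[OF q] by (auto simp: T_def)
        have "{z. T q y z} = g -` D"
          using g transfer unfolding T_def by blast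
        then show ?thesis
          using Linf_bij[OF g(1)] by (simp add: card_vimage_inj bij_is_inj bij_is_surj)
      qed
      show "T (move B x w q) (move B x w y) (move B x w z)"
        if xw: "x \<in> \<Omega>" "w \<in> \<Omega>" and T: "T q y z" for x w q y z
      proof -
        obtain g where g: "g \<in> ?G" "g q = oo" "g y \<in> D" "g z \<in> D"
          using T unfolding T_def by blast
        have "g \<circ> move B x w \<in> ?G" using comp g(1) move_in_Linf[OF grp xw] by blast
        then show ?thesis using g unfolding T_def by (intro bexI[of _ "g \<circ> move B x w"]) auto
      qed
    qed (use tg large \<open>card D \<ge> 2\<close> in auto)
    have "T oo a c" using T_all oo a c D by blast
    then obtain g where "g \<in> ?G" "g oo = oo" "g a \<in> D" "g c \<in> D" by (auto simp: T_def)
    then have "id c \<in> D" using transfer[OF id, of g oo a c] a by simp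
    then show False using c by simp
  qed
qed

end

theorem theoremA:
  fixes \<Omega> :: "'a set" and B :: "'a set multiset" and n lam :: nat and oo :: 'a
  assumes "design_2_4 \<Omega> B n lam"
    and "supersimple B"
    and "n > 2 * lam + 2"
    and "oo \<in> \<Omega>"
  shows "(is_group (Linf \<Omega> B oo) \<longrightarrow> primitive_on (Linf \<Omega> B oo) \<Omega>)
       \<and> (regular_two_graph \<Omega> (collinear_triples B) \<longrightarrow>
            transitive_on (pi_inf \<Omega> B oo) (\<Omega> - {oo}))
       \<and> (regular_two_graph \<Omega> (collinear_triples B) \<and> is_group (Linf \<Omega> B oo) \<longrightarrow>
            primitive_on (pi_inf \<Omega> B oo) (\<Omega> - {oo}))"
proof -
  interpret supersimple_design \<Omega> B n lam
    using assms(1,2) by unfold_locales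
  show ?thesis
    using primitive_Linf transitive_pi_inf primitive_pi_inf assms(3,4) by blast
qed

end
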